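(* Let $m$ and $n$ be positive integers and let $j$, $k$ be non-negative integers. Then $$\frac{(n-k)(k+1)}{n}\binom{n+k}{2k}\binom{m+1}{k+1}\binom{m+k}{k+1}$$ and $$\frac{1}{k+1}\binom{n-1}{k}\binom{n+k}{k}\binom{2k}{j+k}\binom{m+k}{2k}\binom{m}{j}\binom{m+j}{j}$$ are integers.
   Context: Binomial coefficients $\binom{a}{b}$ for integers $a\ge 0$ are taken to be $0$ when $b<0$ or $b>a$. *)

theory Defs
  imports Complex_Main
begin

end

theory Submission
  imports Defs
begin

text \<open>
  Both expressions are integers because of a divisibility by \<open>k + 1\<close> that involves only \<open>m\<close>.
  The first one equals \<open>1/(k+1) * C(n-1,k) C(n+k,k) * m(m+1) C(m+k,2k)\<close>, and
  \<open>m(m+1) = k(k+1) + (m-k)(m+k+1)\<close> shows that \<open>k + 1\<close> divides \<open>m(m+1) C(m+k,2k)\<close>.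
  In the second one, let \<open>S\<close> be the product of the last four binomial coefficients. It can be
  rewritten with a factor \<open>C(m,k)\<close>, so that \<open>k + 1\<close> divides \<open>(m+1) S\<close>; as a polynomial in \<open>m\<close> it is
  invariant under \<open>m \<mapsto> -1-m\<close>, so that it can also be rewritten with a factor \<open>C(m+k,k)\<close>,
  and \<open>k + 1\<close> divides \<open>m S\<close>. Hence \<open>k + 1\<close> divides \<open>S\<close>.
\<close>

lemma Suc_dvd_mult_central_binomial:
  fixes m k :: nat
  shows "k + 1 dvd m * (m + 1) * ((m + k) choose (2 * k))"
proof (cases "k \<le> m")
  case True
  then obtain b where m: "m = k + b"
    using le_Suc_ex by blast
  let ?N = "2 * k + b"
  \<comment> \<open>Two absorption steps turn (m-k)(m+k+1) C(m+k,2k) into (2k+1)(2k+2)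
    C(m+k+1,2k+2), and the factor k+1 comes from 2k+2.\<close>
  have e1: "(2 * k + 1) * (?N choose (2 * k + 1)) = b * (?N choose (2 * k))"
    using binomial_absorb_comp[of ?N "2 * k"] binomial_absorption[of "2 * k" ?N] by simp
  have e2: "(2 * k + 2) * (Suc ?N choose (2 * k + 2)) = Suc ?N * (?N choose (2 * k + 1))"
    using binomial_absorption[of "2 * k + 1" "Suc ?N"] by simp
  have "(2 * k + 1) * (2 * k + 2) * (Suc ?N choose (2 * k + 2))
      = Suc ?N * ((2 * k + 1) * (?N choose (2 * k + 1)))"
    by (simp only: mult.assoc e2 mult.left_commute[of "2 * k + 1"])
  also have "\<dots> = Suc ?N * b * (?N choose (2 * k))"
    by (simp only: e1 mult.assoc)
  finally have e: "Suc ?N * b * (?N choose (2 * k))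
      = (2 * k + 1) * (2 * k + 2) * (Suc ?N choose (2 * k + 2))" ..
  have N: "m + k = ?N"
    by (simp add: m)
  have "m * (m + 1) * ((m + k) choose (2 * k))
      = k * (k + 1) * (?N choose (2 * k)) + Suc ?N * b * (?N choose (2 * k))"
    unfolding N by (simp add: m algebra_simps)
  also have "\<dots> = (k + 1) * (k * (?N choose (2 * k)) + 2 * (2 * k + 1) * (Suc ?N choose (2 * k + 2)))"
    unfolding e by (simp add: algebra_simps)
  finally show ?thesis
    by (rule dvdI)
qed (simp add: binomial_eq_0)

text \<open>Since (n-k)/n * C(n,k) = C(n-1,k), the denominator \<open>n\<close> is absorbed into a
  binomial coefficient. Only \<open>k + 1\<close> is left to cancel, against a factor free of
  \<open>n\<close>.\<close>

lemma first_quotient_eq: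
  fixes m n k :: nat
  assumes "m > 0" "k < n" "k \<le> m"
  shows "(of_nat n - of_nat k) * (of_nat k + 1) / of_nat n
           * of_nat ((n + k) choose (2 * k))
           * of_nat ((m + 1) choose (k + 1))
           * of_nat ((m + k) choose (k + 1))
       = (of_nat (((n - 1) choose k) * ((n + k) choose k)
           * (m * (m + 1) * ((m + k) choose (2 * k)))) / of_nat (k + 1) :: rat)"
proof -
  \<comment> \<open>Here \<open>a\<close>, \<open>b\<close>, \<open>c\<close> stand for n-1-k, m-k,
    m-1. Factorials of neighbouring arguments are reduced to common ones, so that the identity
    becomes a cancellation of nonzero factors.\<close>
  obtain a where n: "n = Suc (k + a)"
    using assms less_iff_Suc_add by blast
  obtain b where m: "m = k + b"
    using assms le_Suc_ex by blast
  obtain c where c: "m = Suc c"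
    using assms gr0_conv_Suc by blast
  define r where "r = (of_nat k :: rat)"
  define s where "s = (of_nat a :: rat)"
  define t where "t = (of_nat c :: rat)"
  have nz: "r + 1 \<noteq> 0" "s + 1 \<noteq> 0" "r + s + 1 \<noteq> 0" "t + 1 \<noteq> 0" "t + 2 \<noteq> 0"
    unfolding r_def s_def t_def by (simp_all add: add_nonneg_pos add_nonneg_eq_0_iff
        order_less_imp_not_eq2)
  have f1: "of_nat ((n + k) choose (2 * k)) = (fact (n + k) / (fact (2 * k) * ((s + 1) * fact a)) :: rat)"
    by (subst binomial_fact) (simp_all add: n s_def add.commute mult.commute)
  have f2: "of_nat ((m + 1) choose (k + 1))
      = ((t + 2) * (t + 1) * fact c / ((r + 1) * fact k * fact b) :: rat)"
  proof -
    have "fact (m + 1) = ((t + 2) * (t + 1) * fact c :: rat)"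
      by (simp add: c t_def add.commute)
    moreover have "m + 1 - (k + 1) = b"
      by (simp add: m)
    ultimately show ?thesis
      using assms by (subst binomial_fact) (simp_all add: r_def)
  qed
  have f3: "of_nat ((m + k) choose (k + 1)) = (fact (m + k) / ((r + 1) * fact k * fact c) :: rat)"
    by (subst binomial_fact) (simp_all add: c r_def mult_ac)
  have f4: "of_nat ((n - 1) choose k) = (fact (k + a) / (fact k * fact a) :: rat)"
    by (subst binomial_fact) (simp_all add: n)
  have f5: "of_nat ((n + k) choose k) = (fact (n + k) / (fact k * ((r + s + 1) * fact (k + a))) :: rat)"
  proof -
    have "fact n = ((r + s + 1) * fact (k + a) :: rat)"
      unfolding n r_def s_def fact_Suc by simp
    then show ?thesis
      by (subst binomial_fact) simp_all
  qed
  have f6: "of_nat ((m + k) choose (2 * k)) = (fact (m + k) / (fact (2 * k) * fact b) :: rat)"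
    by (subst binomial_fact) (simp_all add: m)
  have g: "of_nat n = r + s + 1" "of_nat k = r" "of_nat m = t + 1"
    by (simp_all add: n c r_def s_def t_def)
  show ?thesis
    unfolding of_nat_mult of_nat_add of_nat_1 f1 f2 f3 f4 f5 f6 g
    using nz by simp (simp only: ac_simps)
qed

lemma Suc_dvd_binomial_product:
  fixes m j k :: nat
  shows "k + 1 dvd ((2 * k) choose (j + k)) * ((m + k) choose (2 * k)) * (m choose j) * ((m + j) choose j)"
    (is "_ dvd ?S")
proof (cases "j \<le> k \<and> k \<le> m")
  case True
  then obtain a b where k: "k = j + a" and m: "m = k + b"
    by (metis le_Suc_ex)
  \<comment> \<open>The cofactors of C(m,k) and C(m+k,k) in the product. The map m \<mapsto> -1-m
    exchanges the two binomial coefficients, and also \<open>X\<close> and \<open>Y\<close>, each up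
    to the sign (-1)^k.\<close>
  define X where "X = ((m + k) choose (k + j)) * ((m + j) choose j) * (k choose j)"
  define Y where "Y = ((m + j) choose (k + j)) * (m choose j) * (k choose j)"
  have f1: "of_nat ((2 * k) choose (j + k)) = (fact (2 * k) / (fact (k + j) * fact a) :: rat)"
    by (subst binomial_fact) (simp_all add: k add_ac)
  have f2: "of_nat ((m + k) choose (2 * k)) = (fact (m + k) / (fact (2 * k) * fact b) :: rat)"
    by (subst binomial_fact) (simp_all add: m)
  have f3: "of_nat (m choose j) = (fact m / (fact j * fact (a + b)) :: rat)"
    by (subst binomial_fact) (simp_all add: m k)
  have f4: "of_nat ((m + j) choose j) = (fact (m + j) / (fact j * fact m) :: rat)"
    by (subst binomial_fact) simp_all
  have f5: "of_nat ((m + k) choose (k + j)) = (fact (m + k) / (fact (k + j) * fact (a + b)) :: rat)"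
    by (subst binomial_fact) (simp_all add: m k add.commute)
  have f6: "of_nat (k choose j) = (fact k / (fact j * fact a) :: rat)"
    by (subst binomial_fact) (simp_all add: k)
  have f7: "of_nat (m choose k) = (fact m / (fact k * fact b) :: rat)"
    by (subst binomial_fact) (simp_all add: m)
  have f8: "of_nat ((m + j) choose (k + j)) = (fact (m + j) / (fact (k + j) * fact b) :: rat)"
    by (subst binomial_fact) (simp_all add: m)
  have f9: "of_nat ((m + k) choose k) = (fact (m + k) / (fact k * fact m) :: rat)"
    by (subst binomial_fact) simp_all
  have "(of_nat ?S :: rat) = of_nat (X * (m choose k))"
    unfolding X_def of_nat_mult f1 f2 f3 f4 f5 f6 f7 by simp
  then have X: "?S = X * (m choose k)"
    by (simp only: of_nat_eq_iff)
  have "(of_nat ?S :: rat) = of_nat (Y * ((m + k) choose k))"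
    unfolding Y_def of_nat_mult f1 f2 f3 f4 f6 f8 f9 by simp (simp only: mult_ac)
  then have Y: "?S = Y * ((m + k) choose k)"
    by (simp only: of_nat_eq_iff)
  have eX: "(m + 1) * (m choose k) = (k + 1) * (Suc m choose Suc k)"
    using Suc_times_binomial_eq[of m k] by (simp add: mult.commute)
  have eY: "m * ((m + k) choose k) = (k + 1) * ((m + k) choose Suc k)"
    using binomial_absorb_comp[of "m + k" k] binomial_absorption[of k "m + k"] by simp
  have "k + 1 dvd (m + 1) * ?S"
    unfolding X mult.left_commute[of _ X] eX by (intro dvd_mult dvd_triv_left)
  moreover have "k + 1 dvd m * ?S"
    unfolding Y mult.left_commute[of _ Y] eY by (intro dvd_mult dvd_triv_left)
  \<comment> \<open>The two multiples of \<open>k + 1\<close> differ by the product itself.\<close>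
  ultimately show ?thesis
    by (simp add: dvd_add_left_iff)
qed (auto simp: not_le binomial_eq_0)

lemma of_nat_divide_in_Ints:
  fixes a b :: nat
  assumes "a dvd b"
  shows "(of_nat b / of_nat a :: 'a :: field_char_0) \<in> \<int>"
proof -
  obtain c where "b = a * c"
    using assms by (rule dvdE)
  then show ?thesis
    by (cases "a = 0") simp_all
qed

theorem theorem1p2:
  fixes m n j k :: nat
  assumes "m > 0" and "n > 0"
  shows "(of_nat n - of_nat k) * (of_nat k + 1) / of_nat n
           * of_nat ((n + k) choose (2 * k))
           * of_nat ((m + 1) choose (k + 1))
           * of_nat ((m + k) choose (k + 1)) \<in> (\<int> :: rat set) \<and>
         1 / (of_nat k + 1)
           * of_nat ((n - 1) choose k)
           * of_nat ((n + k) choose k)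
           * of_nat ((2 * k) choose (j + k))
           * of_nat ((m + k) choose (2 * k))
           * of_nat (m choose j)
           * of_nat ((m + j) choose j) \<in> (\<int> :: rat set)"
  (is "?P \<in> _ \<and> ?Q \<in> _")
proof
  show "?P \<in> \<int>"
  proof (cases "k < n \<and> k \<le> m")
    case True
    with assms have "?P = of_nat (((n - 1) choose k) * ((n + k) choose k)
        * (m * (m + 1) * ((m + k) choose (2 * k)))) / of_nat (k + 1)"
      by (intro first_quotient_eq) auto
    also have "\<dots> \<in> \<int>"
      by (intro of_nat_divide_in_Ints dvd_mult[OF Suc_dvd_mult_central_binomial])
    finally show ?thesis .
  next
    case False
    \<comment> \<open>The vanishing factors are n-k (a rational difference, not truncated),
      C(n+k,2k) and C(m+1,k+1) respectively.\<close>
    then consider "k = n" | "n < k" | "m < k"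
      by linarith
    then have "?P = 0"
      by cases (simp_all add: binomial_eq_0)
    then show ?thesis
      by (simp only: Ints_0)
  qed
next
  let ?A = "((n - 1) choose k) * ((n + k) choose k)"
  let ?S = "((2 * k) choose (j + k)) * ((m + k) choose (2 * k)) * (m choose j) * ((m + j) choose j)"
  \<comment> \<open>No case split is needed: \<open>?A\<close> is a natural number for every
    \<open>k\<close>, and \<open>k + 1\<close> divides \<open>?S\<close>.\<close>
  have "?Q = of_nat (?A * ?S) / of_nat (k + 1)"
    by (simp add: mult_ac add_ac)
  also have "\<dots> \<in> \<int>"
    by (intro of_nat_divide_in_Ints dvd_mult[OF Suc_dvd_binomial_product])
  finally show "?Q \<in> \<int>" .
qed

end
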